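(* Let $\mathcal{N}$ (with universe $N$) be a substructure of a structure $\mathcal{M}$ (with universe $M$) in a signature $\Sigma$. Then the following conditions are equivalent: (1) $\mathcal{N}$ is an elementary substructure of $\mathcal{M}$; (2) for any formula $\varphi(x_1,\ldots,x_n,y)$ of the signature $\Sigma$ and any elements $a_1,\ldots,a_n\in N$, if $\mathcal{M}\models\exists y\,\varphi(a_1,\ldots,a_n,y)$ then $\varphi(x_1,\ldots,x_n,y)$ is ($\forall$-) $\exists$-partially $(\{a_1\},\ldots,\{a_n\},N)$-preserving; (3) for any formula $\varphi(x_1,\ldots,x_n,y)$ of the signature $\Sigma$ and any elements $a_1,\ldots,a_n\in N$, either $\varphi(x_1,\ldots,x_n,y)$ is $(\{a_1\},\ldots,\{a_n\},M)$-disjoint or $\varphi(x_1,\ldots,x_n,y)$ is ($\forall$-) $\exists$-partially $(\{a_1\},\ldots,\{a_n\},N)$-preserving; (4) for any finite type $\Phi(x_1,\ldots,x_n,y)$ of the signature $\Sigma$ and any elements $a_1,\ldots,a_n\in N$, either $\Phi(x_1,\ldots,x_n,y)$ is $(\{a_1\},\ldots,\{a_n\},M)$-disjoint or $\Phi(x_1,\ldots,x_n,y)$ is ($\forall$-) $\exists$-partially $(\{a_1\},\ldots,\{a_n\},N)$-preserving.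
   Context: All preservation notions are taken in $\mathcal{M}$. For a type (set of formulas) $\Phi(x_1,\ldots,x_n,y)$, $\Phi(a_1,\ldots,a_n,\mathcal{M})$ is the set of all $b\in M$ such that $\mathcal{M}\models\varphi(a_1,\ldots,a_n,b)$ for all $\varphi\in\Phi$; a formula $\varphi$ is treated as the type $\{\varphi\}$. For $P_1,\ldots,P_n,Q\subseteq M$, $\Phi$ is $\exists$-partially (respectively $\forall$-partially) $(P_1,\ldots,P_n,Q)$-preserving if $\Phi(a_1,\ldots,a_n,\mathcal{M})\cap Q\neq\emptyset$ for some (respectively all) $a_1\in P_1,\ldots,a_n\in P_n$; for singletons $P_i=\{a_i\}$ the two notions coincide, and each may be used. $\Phi$ is $(\{a_1\},\ldots,\{a_n\},Q)$-disjoint if $\Phi(a_1,\ldots,a_n,\mathcal{M})\subseteq M\setminus Q$; in particular for $Q=M$ this says $\Phi(a_1,\ldots,a_n,\mathcal{M})=\emptyset$. *)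

theory Defs
  imports Main
begin

text \<open>
  The symbols of a signature form subsets of the symbol types, so that either kind of symbol
  may be absent; constants are the function symbols of arity 0.
\<close>

record ('f, 'r) signature =
  fun_syms :: "'f set"
  rel_syms :: "'r set"
  fun_arity :: "'f \<Rightarrow> nat"
  rel_arity :: "'r \<Rightarrow> nat"

datatype 'f tm = Var nat | App 'f "'f tm list"

datatype ('f, 'r) fm =
    Equal "'f tm" "'f tm"
  | Atom 'r "'f tm list"
  | Neg "('f, 'r) fm"
  | Conj "('f, 'r) fm" "('f, 'r) fm"
  | Disj "('f, 'r) fm" "('f, 'r) fm"
  | Impl "('f, 'r) fm" "('f, 'r) fm"
  | Exists nat "('f, 'r) fm"
  | Forall nat "('f, 'r) fm"

fun tm_vars :: "'f tm \<Rightarrow> nat set" where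
  "tm_vars (Var x) = {x}"
| "tm_vars (App f ts) = (\<Union>t \<in> set ts. tm_vars t)"

fun free_vars :: "('f, 'r) fm \<Rightarrow> nat set" where
  "free_vars (Equal s t) = tm_vars s \<union> tm_vars t"
| "free_vars (Atom r ts) = (\<Union>t \<in> set ts. tm_vars t)"
| "free_vars (Neg \<phi>) = free_vars \<phi>"
| "free_vars (Conj \<phi> \<psi>) = free_vars \<phi> \<union> free_vars \<psi>"
| "free_vars (Disj \<phi> \<psi>) = free_vars \<phi> \<union> free_vars \<psi>"
| "free_vars (Impl \<phi> \<psi>) = free_vars \<phi> \<union> free_vars \<psi>"
| "free_vars (Exists x \<phi>) = free_vars \<phi> - {x}"
| "free_vars (Forall x \<phi>) = free_vars \<phi> - {x}"

fun tm_of :: "('f, 'r) signature \<Rightarrow> 'f tm \<Rightarrow> bool" where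
  "tm_of \<Sigma> (Var x) \<longleftrightarrow> True"
| "tm_of \<Sigma> (App f ts) \<longleftrightarrow>
     f \<in> fun_syms \<Sigma> \<and> length ts = fun_arity \<Sigma> f \<and> (\<forall>t \<in> set ts. tm_of \<Sigma> t)"

fun fm_of :: "('f, 'r) signature \<Rightarrow> ('f, 'r) fm \<Rightarrow> bool" where
  "fm_of \<Sigma> (Equal s t) \<longleftrightarrow> tm_of \<Sigma> s \<and> tm_of \<Sigma> t"
| "fm_of \<Sigma> (Atom r ts) \<longleftrightarrow>
     r \<in> rel_syms \<Sigma> \<and> length ts = rel_arity \<Sigma> r \<and> (\<forall>t \<in> set ts. tm_of \<Sigma> t)"
| "fm_of \<Sigma> (Neg \<phi>) \<longleftrightarrow> fm_of \<Sigma> \<phi>"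
| "fm_of \<Sigma> (Conj \<phi> \<psi>) \<longleftrightarrow> fm_of \<Sigma> \<phi> \<and> fm_of \<Sigma> \<psi>"
| "fm_of \<Sigma> (Disj \<phi> \<psi>) \<longleftrightarrow> fm_of \<Sigma> \<phi> \<and> fm_of \<Sigma> \<psi>"
| "fm_of \<Sigma> (Impl \<phi> \<psi>) \<longleftrightarrow> fm_of \<Sigma> \<phi> \<and> fm_of \<Sigma> \<psi>"
| "fm_of \<Sigma> (Exists x \<phi>) \<longleftrightarrow> fm_of \<Sigma> \<phi>"
| "fm_of \<Sigma> (Forall x \<phi>) \<longleftrightarrow> fm_of \<Sigma> \<phi>"

text \<open>
  The notation \<open>\<phi>(v\<^sub>1,\<dots>,v\<^sub>k)\<close>: the \<open>v\<^sub>i\<close> are pairwise distinct variables among which all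
  free variables of \<open>\<phi>\<close> occur (not every \<open>v\<^sub>i\<close> need be free in \<open>\<phi>\<close>).
\<close>

definition formula_in ::
    "('f, 'r) signature \<Rightarrow> nat list \<Rightarrow> ('f, 'r) fm \<Rightarrow> bool" where
  "formula_in \<Sigma> vs \<phi> \<longleftrightarrow> distinct vs \<and> fm_of \<Sigma> \<phi> \<and> free_vars \<phi> \<subseteq> set vs"

text \<open>
  A type need not be complete or consistent; distinctness is required separately because
  the set of formulas may be empty.
\<close>

definition type_in ::
    "('f, 'r) signature \<Rightarrow> nat list \<Rightarrow> ('f, 'r) fm set \<Rightarrow> bool" where
  "type_in \<Sigma> vs \<Phi> \<longleftrightarrow> distinct vs \<and> (\<forall>\<phi> \<in> \<Phi>. formula_in \<Sigma> vs \<phi>)"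

record ('f, 'r, 'a) struct =
  universe :: "'a set"
  fun_int :: "'f \<Rightarrow> 'a list \<Rightarrow> 'a"
  rel_int :: "'r \<Rightarrow> 'a list \<Rightarrow> bool"

definition tuples :: "nat \<Rightarrow> 'a set \<Rightarrow> 'a list set" where
  "tuples n A = {as. length as = n \<and> set as \<subseteq> A}"

text \<open>
  Interpretations are only meaningful for symbols of the signature, applied to tuples of
  elements of the universe of the right length.
\<close>

definition structure_of ::
    "('f, 'r) signature \<Rightarrow> ('f, 'r, 'a) struct \<Rightarrow> bool" where
  "structure_of \<Sigma> M \<longleftrightarrow>
     universe M \<noteq> {} \<and>
     (\<forall>f \<in> fun_syms \<Sigma>. \<forall>as \<in> tuples (fun_arity \<Sigma> f) (universe M). fun_int M f as \<in> universe M)"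

definition substructure ::
    "('f, 'r) signature \<Rightarrow> ('f, 'r, 'a) struct \<Rightarrow> ('f, 'r, 'a) struct \<Rightarrow> bool" where
  "substructure \<Sigma> N M \<longleftrightarrow>
     structure_of \<Sigma> N \<and> structure_of \<Sigma> M \<and> universe N \<subseteq> universe M \<and>
     (\<forall>f \<in> fun_syms \<Sigma>. \<forall>as \<in> tuples (fun_arity \<Sigma> f) (universe N).
        fun_int N f as = fun_int M f as) \<and>
     (\<forall>r \<in> rel_syms \<Sigma>. \<forall>as \<in> tuples (rel_arity \<Sigma> r) (universe N).
        rel_int N r as \<longleftrightarrow> rel_int M r as)"

fun tm_val :: "('f, 'r, 'a) struct \<Rightarrow> (nat \<Rightarrow> 'a) \<Rightarrow> 'f tm \<Rightarrow> 'a" where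
  "tm_val M s (Var x) = s x"
| "tm_val M s (App f ts) = fun_int M f (map (tm_val M s) ts)"

fun sat :: "('f, 'r, 'a) struct \<Rightarrow> (nat \<Rightarrow> 'a) \<Rightarrow> ('f, 'r) fm \<Rightarrow> bool" where
  "sat M s (Equal t u) \<longleftrightarrow> tm_val M s t = tm_val M s u"
| "sat M s (Atom r ts) \<longleftrightarrow> rel_int M r (map (tm_val M s) ts)"
| "sat M s (Neg \<phi>) \<longleftrightarrow> \<not> sat M s \<phi>"
| "sat M s (Conj \<phi> \<psi>) \<longleftrightarrow> sat M s \<phi> \<and> sat M s \<psi>"
| "sat M s (Disj \<phi> \<psi>) \<longleftrightarrow> sat M s \<phi> \<or> sat M s \<psi>"
| "sat M s (Impl \<phi> \<psi>) \<longleftrightarrow> (sat M s \<phi> \<longrightarrow> sat M s \<psi>)"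
| "sat M s (Exists x \<phi>) \<longleftrightarrow> (\<exists>b \<in> universe M. sat M (s(x := b)) \<phi>)"
| "sat M s (Forall x \<phi>) \<longleftrightarrow> (\<forall>b \<in> universe M. sat M (s(x := b)) \<phi>)"

text \<open>
  \<open>M \<Turnstile> \<phi>(a\<^sub>1,\<dots>,a\<^sub>k)\<close> for \<open>\<phi>(v\<^sub>1,\<dots>,v\<^sub>k)\<close>. The value \<open>undefined\<close> is given only to variables
  outside \<open>vs\<close>, which are not free in \<open>\<phi>\<close> when \<open>formula_in \<Sigma> vs \<phi>\<close>.
\<close>

definition assignment :: "nat list \<Rightarrow> 'a list \<Rightarrow> nat \<Rightarrow> 'a" where
  "assignment vs as v = (case map_of (zip vs as) v of Some a \<Rightarrow> a | None \<Rightarrow> undefined)"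

definition holds ::
    "('f, 'r, 'a) struct \<Rightarrow> nat list \<Rightarrow> ('f, 'r) fm \<Rightarrow> 'a list \<Rightarrow> bool" where
  "holds M vs \<phi> as \<longleftrightarrow> sat M (assignment vs as) \<phi>"

definition elementary_substructure ::
    "('f, 'r) signature \<Rightarrow> ('f, 'r, 'a) struct \<Rightarrow> ('f, 'r, 'a) struct \<Rightarrow> bool" where
  "elementary_substructure \<Sigma> N M \<longleftrightarrow>
     substructure \<Sigma> N M \<and>
     (\<forall>xs \<phi>. formula_in \<Sigma> xs \<phi> \<longrightarrow>
        (\<forall>as \<in> tuples (length xs) (universe N). holds N xs \<phi> as \<longleftrightarrow> holds M xs \<phi> as))"

text \<open>The set \<open>\<Phi>(a\<^sub>1,\<dots>,a\<^sub>n,M)\<close> for a type \<open>\<Phi>(x\<^sub>1,\<dots>,x\<^sub>n,y)\<close>.\<close>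

definition solutions ::
    "('f, 'r, 'a) struct \<Rightarrow> nat list \<Rightarrow> nat \<Rightarrow> ('f, 'r) fm set \<Rightarrow> 'a list \<Rightarrow> 'a set" where
  "solutions M xs y \<Phi> as = {b \<in> universe M. \<forall>\<phi> \<in> \<Phi>. holds M (xs @ [y]) \<phi> (as @ [b])}"

text \<open>
  In the next two definitions \<open>Ps = [P\<^sub>1,\<dots>,P\<^sub>n]\<close>, and \<open>listset Ps\<close> is the product
  \<open>P\<^sub>1 \<times> \<dots> \<times> P\<^sub>n\<close>.
\<close>

definition ex_partially_preserving ::
    "('f, 'r, 'a) struct \<Rightarrow> nat list \<Rightarrow> nat \<Rightarrow> ('f, 'r) fm set \<Rightarrow> 'a set list \<Rightarrow> 'a set \<Rightarrow> bool" where
  "ex_partially_preserving M xs y \<Phi> Ps Q \<longleftrightarrow>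
     (\<exists>as \<in> listset Ps. solutions M xs y \<Phi> as \<inter> Q \<noteq> {})"

definition all_partially_preserving ::
    "('f, 'r, 'a) struct \<Rightarrow> nat list \<Rightarrow> nat \<Rightarrow> ('f, 'r) fm set \<Rightarrow> 'a set list \<Rightarrow> 'a set \<Rightarrow> bool" where
  "all_partially_preserving M xs y \<Phi> Ps Q \<longleftrightarrow>
     (\<forall>as \<in> listset Ps. solutions M xs y \<Phi> as \<inter> Q \<noteq> {})"

abbreviation singletons :: "'a list \<Rightarrow> 'a set list" where
  "singletons as \<equiv> map (\<lambda>a. {a}) as"

text \<open>
  \<open>({a\<^sub>1},\<dots>,{a\<^sub>n},Q)\<close>-disjointness: the notion is only used for singletons, hence the tuple
  \<open>as\<close> of elements in place of a tuple of sets.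
\<close>

definition disjoint_at ::
    "('f, 'r, 'a) struct \<Rightarrow> nat list \<Rightarrow> nat \<Rightarrow> ('f, 'r) fm set \<Rightarrow> 'a list \<Rightarrow> 'a set \<Rightarrow> bool" where
  "disjoint_at M xs y \<Phi> as Q \<longleftrightarrow> solutions M xs y \<Phi> as \<subseteq> universe M - Q"

end

theory Submission imports Defs begin

text \<open>
  All four conditions are variants of the Tarski--Vaught test. A finite type is equivalent to the
  conjunction of its formulas, so an elementary substructure realises every finite type over it
  that \<open>M\<close> realises. Conversely, if every formula over \<open>N\<close> solvable in \<open>M\<close> is solvable in \<open>N\<close>,
  then \<open>N\<close> and \<open>M\<close> agree on all formulas by induction, where \<open>\<forall>\<close> is treated as \<open>\<not>\<exists>\<not>\<close>.
\<close>

section \<open>Dependence of values and truth on the occurring variables\<close>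

lemma tm_val_cong: "(\<And>v. v \<in> tm_vars t \<Longrightarrow> s v = s' v) \<Longrightarrow> tm_val M s t = tm_val M s' t"
proof (induction t)
  case (App f ts)
  have "map (tm_val M s) ts = map (tm_val M s') ts"
    using App by (intro map_cong refl) auto
  then show ?case by (simp del: map_eq_conv)
qed simp

text \<open>At a quantifier the updated assignments agree on the bound variable by construction and
  on the other free variables of the body by hypothesis; hence the induction is over arbitrary
  \<open>s\<close> and \<open>s'\<close>.\<close>

lemma sat_cong: "(\<And>v. v \<in> free_vars \<phi> \<Longrightarrow> s v = s' v) \<Longrightarrow> sat M s \<phi> \<longleftrightarrow> sat M s' \<phi>"
proof (induction \<phi> arbitrary: s s')
  case (Equal t u)
  then show ?case using tm_val_cong[of t s s' M] tm_val_cong[of u s s' M] by simp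
next
  case (Atom r ts)
  have "map (tm_val M s) ts = map (tm_val M s') ts"
    using Atom by (intro map_cong refl tm_val_cong) auto
  then show ?case by (simp del: map_eq_conv)
next
  case (Neg \<phi>)
  then show ?case by (metis free_vars.simps(3) sat.simps(3))
next
  case (Conj \<phi> \<psi>)
  then show ?case by (metis UnCI free_vars.simps(4) sat.simps(4))
next
  case (Disj \<phi> \<psi>)
  then show ?case by (metis UnCI free_vars.simps(5) sat.simps(5))
next
  case (Impl \<phi> \<psi>)
  then show ?case by (metis UnCI free_vars.simps(6) sat.simps(6))
next
  case (Exists x \<phi>)
  have "sat M (s(x := b)) \<phi> \<longleftrightarrow> sat M (s'(x := b)) \<phi>" for b
    using Exists.prems by (intro Exists.IH) auto
  then show ?case by simp
next
  case (Forall x \<phi>)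
  have "sat M (s(x := b)) \<phi> \<longleftrightarrow> sat M (s'(x := b)) \<phi>" for b
    using Forall.prems by (intro Forall.IH) auto
  then show ?case by simp
qed

lemma finite_tm_vars: "finite (tm_vars t)"
  by (induction t) auto

lemma finite_free_vars: "finite (free_vars \<phi>)"
  by (induction \<phi>) (auto simp: finite_tm_vars)

section \<open>Assignments given by tuples\<close>

lemma assignment_map:
  assumes "v \<in> set xs" shows "assignment xs (map s xs) v = s v"
  using assms by (simp add: assignment_def map_of_zip_map)

lemma assignment_in:
  assumes "as \<in> tuples (length xs) A" "v \<in> set xs"
  shows "assignment xs as v \<in> A"
proof -
  from assms obtain a where a: "map_of (zip xs as) v = Some a"
    using map_of_zip_is_Some[of xs as v] by (auto simp: tuples_def)
  then have "a \<in> set as" by (meson map_of_SomeD set_zip_rightD)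
  with a assms show ?thesis by (auto simp: assignment_def tuples_def)
qed

text \<open>A lookup in the zipped list returns the first match, so an occurrence of
  \<open>y\<close> in \<open>xs\<close> would shadow the appended value \<open>b\<close>.\<close>

lemma assignment_snoc:
  assumes "length as = length xs" "y \<notin> set xs"
  shows "assignment (xs @ [y]) (as @ [b]) = (assignment xs as)(y := b)"
proof
  fix v
  have "map_of (zip xs as) y = None"
    using assms by (simp add: map_of_zip_is_None)
  then show "assignment (xs @ [y]) (as @ [b]) v = ((assignment xs as)(y := b)) v"
    using assms(1)
    by (cases "v = y")
      (simp_all add: assignment_def map_add_def del: map_of_zip_is_None split: option.split)
qed

section \<open>Existential formulas and finite types\<close>

lemma formula_in_Exists:
  "formula_in \<Sigma> (xs @ [y]) \<phi> \<Longrightarrow> formula_in \<Sigma> xs (Exists y \<phi>)"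
  by (auto simp: formula_in_def)

text \<open>Distinctness of \<open>xs @ [y]\<close> keeps \<open>y\<close> out of \<open>xs\<close>.
  Appending \<open>b\<close> to the tuple is then the same as the update by which \<open>sat\<close>
  interprets the quantifier.\<close>

lemma holds_Exists_iff:
  assumes "formula_in \<Sigma> (xs @ [y]) \<phi>" "length as = length xs"
  shows "holds M xs (Exists y \<phi>) as \<longleftrightarrow> solutions M xs y {\<phi>} as \<noteq> {}"
  using assms assignment_snoc[OF assms(2)]
  by (auto simp: formula_in_def holds_def solutions_def)

text \<open>For the empty type the conjunction is the tautology \<open>y = y\<close>.\<close>

lemma finite_type_conjunction:
  fixes \<Sigma> :: "('f, 'r) signature"
  assumes "finite \<Phi>" "type_in \<Sigma> (xs @ [y]) \<Phi>"
  obtains \<chi> where "formula_in \<Sigma> (xs @ [y]) \<chi>"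
    "\<And>(M :: ('f, 'r, 'a) struct) s. sat M s \<chi> \<longleftrightarrow> (\<forall>\<phi>\<in>\<Phi>. sat M s \<phi>)"
proof -
  have "\<exists>\<chi>. formula_in \<Sigma> (xs @ [y]) \<chi> \<and>
      (\<forall>(M :: ('f, 'r, 'a) struct) s. sat M s \<chi> \<longleftrightarrow> (\<forall>\<phi>\<in>\<Phi>. sat M s \<phi>))"
    using assms
  proof (induction \<Phi>)
    case empty
    then have "formula_in \<Sigma> (xs @ [y]) (Equal (Var y) (Var y))"
      by (simp add: type_in_def formula_in_def)
    then show ?case by (intro exI[of _ "Equal (Var y) (Var y)"]) simp
  next
    case (insert \<phi> \<Phi>)
    then obtain \<chi> where "formula_in \<Sigma> (xs @ [y]) \<chi>"
      "\<And>(M :: ('f, 'r, 'a) struct) s. sat M s \<chi> \<longleftrightarrow> (\<forall>\<phi>\<in>\<Phi>. sat M s \<phi>)"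
      by (auto simp: type_in_def)
    then show ?case
      using insert.prems
      by (intro exI[of _ "Conj \<phi> \<chi>"]) (auto simp: type_in_def formula_in_def)
  qed
  then show ?thesis using that by blast
qed

section \<open>Terms and atomic formulas in a substructure\<close>

lemma substructure_tm_val:
  assumes "substructure \<Sigma> N M"
  shows "tm_of \<Sigma> t \<Longrightarrow> s ` tm_vars t \<subseteq> universe N \<Longrightarrow>
    tm_val N s t = tm_val M s t \<and> tm_val M s t \<in> universe N"
proof (induction t)
  case (App f ts)
  \<comment> \<open>The interpretations of \<open>f\<close> are known to agree only on tuples from
    \<open>N\<close>, so membership of the arguments in \<open>N\<close> must be carried through the
    induction.\<close>
  then have IH: "\<And>t. t \<in> set ts \<Longrightarrow> tm_val N s t = tm_val M s t \<and> tm_val M s t \<in> universe N"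
    by fastforce
  then have "map (tm_val N s) ts = map (tm_val M s) ts"
    by (intro map_cong refl) auto
  moreover have "map (tm_val N s) ts \<in> tuples (fun_arity \<Sigma> f) (universe N)"
    using App.prems IH by (auto simp: tuples_def)
  moreover have "f \<in> fun_syms \<Sigma>"
    using App.prems(1) by simp
  ultimately show ?case
    using assms unfolding substructure_def structure_of_def tm_val.simps by metis
qed simp

lemma substructure_map_tm_val:
  assumes "substructure \<Sigma> N M" "\<forall>t\<in>set ts. tm_of \<Sigma> t" "s ` (\<Union>t\<in>set ts. tm_vars t) \<subseteq> universe N"
  shows "map (tm_val N s) ts = map (tm_val M s) ts"
    and "map (tm_val N s) ts \<in> tuples (length ts) (universe N)"
proof -
  have "tm_val N s t = tm_val M s t \<and> tm_val M s t \<in> universe N" if "t \<in> set ts" for t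
    using assms that by (intro substructure_tm_val) auto
  then show "map (tm_val N s) ts = map (tm_val M s) ts"
    and "map (tm_val N s) ts \<in> tuples (length ts) (universe N)"
    by (auto simp: tuples_def)
qed

section \<open>The Tarski-Vaught test, phrased by solution sets in \<open>M\<close> alone\<close>

definition tarski_vaught ::
    "('f, 'r) signature \<Rightarrow> ('f, 'r, 'a) struct \<Rightarrow> ('f, 'r, 'a) struct \<Rightarrow> bool" where
  "tarski_vaught \<Sigma> N M \<longleftrightarrow>
     (\<forall>xs y \<phi>. formula_in \<Sigma> (xs @ [y]) \<phi> \<longrightarrow>
        (\<forall>as \<in> tuples (length xs) (universe N).
           solutions M xs y {\<phi>} as \<noteq> {} \<longrightarrow> solutions M xs y {\<phi>} as \<inter> universe N \<noteq> {}))"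

text \<open>This carries the test from tuples over to arbitrary assignments and bound variables, the
  form needed at quantifiers in an induction on formulas.\<close>

lemma tarski_vaught_witness:
  assumes tv: "tarski_vaught \<Sigma> N M" and sub: "universe N \<subseteq> universe M"
    and \<phi>: "fm_of \<Sigma> \<phi>" and s: "s ` (free_vars \<phi> - {x}) \<subseteq> universe N"
  shows "(\<exists>b\<in>universe M. sat M (s(x := b)) \<phi>) \<longleftrightarrow> (\<exists>b\<in>universe N. sat M (s(x := b)) \<phi>)"
proof -
  \<comment> \<open>The parameters are the finitely many free variables other than \<open>x\<close>.
    Leaving out \<open>x\<close> makes \<open>xs @ [x]\<close> distinct, whether or not
    \<open>x\<close> is free in \<open>\<phi>\<close>.\<close>
  define xs where "xs = sorted_list_of_set (free_vars \<phi> - {x})"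
  have xs: "set xs = free_vars \<phi> - {x}" "distinct xs"
    by (simp_all add: xs_def finite_free_vars)
  have as: "map s xs \<in> tuples (length xs) (universe N)"
    using s xs by (auto simp: tuples_def)
  have "formula_in \<Sigma> (xs @ [x]) \<phi>"
    using \<phi> xs by (auto simp: formula_in_def)
  note tv' = tv[unfolded tarski_vaught_def, rule_format, OF this as]
  \<comment> \<open>The two assignments may differ outside \<open>xs @ [x]\<close>, where the tuple
    assignment is \<open>undefined\<close>; no such variable is free in
    \<open>\<phi>\<close>.\<close>
  have "holds M (xs @ [x]) \<phi> (map s xs @ [b]) \<longleftrightarrow> sat M (s(x := b)) \<phi>" for b
    unfolding holds_def
    by (rule sat_cong) (use xs in \<open>auto simp: assignment_snoc assignment_map\<close>)
  then have "solutions M xs x {\<phi>} (map s xs) = {b \<in> universe M. sat M (s(x := b)) \<phi>}"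
    by (simp add: solutions_def)
  with tv' sub show ?thesis by auto
qed

text \<open>At a quantifier the induction hypothesis compares the structures only for witnesses in
  \<open>N\<close>; the test then shows that \<open>M\<close> offers a witness exactly when
  \<open>N\<close> does. Constraining \<open>s\<close> only on the free variables allows arbitrary
  values elsewhere.\<close>

lemma tarski_vaught_sat:
  assumes sub: "substructure \<Sigma> N M" and tv: "tarski_vaught \<Sigma> N M"
  shows "fm_of \<Sigma> \<phi> \<Longrightarrow> s ` free_vars \<phi> \<subseteq> universe N \<Longrightarrow> sat N s \<phi> \<longleftrightarrow> sat M s \<phi>"
proof (induction \<phi> arbitrary: s)
  case (Equal t u)
  then show ?case
    using substructure_tm_val[OF sub, of t s] substructure_tm_val[OF sub, of u s]
    by (simp add: image_Un)
next
  case (Atom r ts)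
  then show ?case
    using sub substructure_map_tm_val[OF sub, of ts s]
    by (auto simp: substructure_def simp del: map_eq_conv)
next
  case (Exists x \<phi>)
  have "sat N (s(x := b)) \<phi> \<longleftrightarrow> sat M (s(x := b)) \<phi>" if "b \<in> universe N" for b
    using Exists.prems that by (intro Exists.IH) auto
  then show ?case
    using tarski_vaught_witness[OF tv, of \<phi> s x] Exists.prems sub
    by (auto simp: substructure_def)
next
  case (Forall x \<phi>)
  have "sat N (s(x := b)) \<phi> \<longleftrightarrow> sat M (s(x := b)) \<phi>" if "b \<in> universe N" for b
    using Forall.prems that by (intro Forall.IH) auto
  \<comment> \<open>Applied to \<open>Neg \<phi>\<close>, the test says that a counterexample in
    \<open>M\<close> exists iff one exists in \<open>N\<close>.\<close>
  then show ?case
    using tarski_vaught_witness[OF tv, of "Neg \<phi>" s x] Forall.prems sub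
    by (auto simp: substructure_def)
qed (auto simp: image_Un)

lemma tarski_vaught_imp_elementary:
  assumes sub: "substructure \<Sigma> N M" and tv: "tarski_vaught \<Sigma> N M"
  shows "elementary_substructure \<Sigma> N M"
  unfolding elementary_substructure_def
proof (intro conjI allI impI ballI sub)
  fix xs \<phi> as
  assume "formula_in \<Sigma> xs \<phi>" and as: "as \<in> tuples (length xs) (universe N)"
  then have \<phi>: "fm_of \<Sigma> \<phi>" "free_vars \<phi> \<subseteq> set xs"
    by (auto simp: formula_in_def)
  show "holds N xs \<phi> as \<longleftrightarrow> holds M xs \<phi> as"
    unfolding holds_def
    using \<phi> assignment_in[OF as] by (intro tarski_vaught_sat[OF sub tv]) auto
qed

text \<open>Finiteness turns the type into one formula \<open>\<chi>\<close>. Elementarity is then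
  used twice: to move \<open>Exists y \<chi>\<close> from \<open>M\<close> down to \<open>N\<close>,
  and to move \<open>\<chi>\<close> at the witness found in \<open>N\<close> back up to
  \<open>M\<close>.\<close>

lemma elementary_realises_finite_type:
  fixes M N :: "('f, 'r, 'a) struct"
  assumes elem: "elementary_substructure \<Sigma> N M"
    and \<Phi>: "finite \<Phi>" "type_in \<Sigma> (xs @ [y]) \<Phi>"
    and as: "as \<in> tuples (length xs) (universe N)"
    and ne: "solutions M xs y \<Phi> as \<noteq> {}"
  shows "solutions M xs y \<Phi> as \<inter> universe N \<noteq> {}"
proof -
  obtain \<chi> where \<chi>: "formula_in \<Sigma> (xs @ [y]) \<chi>"
    and sat: "\<And>(K :: ('f, 'r, 'a) struct) s. sat K s \<chi> \<longleftrightarrow> (\<forall>\<phi>\<in>\<Phi>. sat K s \<phi>)"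
    using finite_type_conjunction[OF \<Phi>, where 'a = 'a] by blast
  have len: "length as = length xs"
    using as by (simp add: tuples_def)
  have sol: "solutions K xs y \<Phi> as = solutions K xs y {\<chi>} as" for K :: "('f, 'r, 'a) struct"
    by (simp add: solutions_def holds_def sat)
  have "holds M xs (Exists y \<chi>) as"
    using ne holds_Exists_iff[OF \<chi> len] sol by simp
  then have "holds N xs (Exists y \<chi>) as"
    using elem formula_in_Exists[OF \<chi>] as by (simp add: elementary_substructure_def)
  then obtain b where b: "b \<in> universe N" "holds N (xs @ [y]) \<chi> (as @ [b])"
    using holds_Exists_iff[OF \<chi> len] by (auto simp: solutions_def)
  have "as @ [b] \<in> tuples (length (xs @ [y])) (universe N)"
    using as b by (auto simp: tuples_def)
  then have "holds M (xs @ [y]) \<chi> (as @ [b])"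
    using b elem \<chi> unfolding elementary_substructure_def by blast
  moreover have "b \<in> universe M"
    using b elem by (auto simp: elementary_substructure_def substructure_def)
  ultimately show ?thesis
    using b by (auto simp: sol) (auto simp: solutions_def)
qed

section \<open>Reduction of the conditions to the test\<close>

lemma listset_singletons: "listset (singletons as) = {as}"
  by (induction as) (auto simp: set_Cons_def)

lemma disjoint_at_universe_iff:
  "disjoint_at M xs y \<Phi> as (universe M) \<longleftrightarrow> solutions M xs y \<Phi> as = {}"
  by (auto simp: disjoint_at_def)

theorem corollary6p2:
  fixes \<Sigma> :: "('f, 'r) signature"
    and M N :: "('f, 'r, 'a) struct"
    and preserving :: "('f, 'r, 'a) struct \<Rightarrow> nat list \<Rightarrow> nat \<Rightarrow> ('f, 'r) fm set
                         \<Rightarrow> 'a set list \<Rightarrow> 'a set \<Rightarrow> bool"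
  assumes sub: "substructure \<Sigma> N M"
    and pres: "preserving = ex_partially_preserving \<or> preserving = all_partially_preserving"
  shows
    "(elementary_substructure \<Sigma> N M \<longleftrightarrow>
       (\<forall>xs y \<phi>. formula_in \<Sigma> (xs @ [y]) \<phi> \<longrightarrow>
          (\<forall>as \<in> tuples (length xs) (universe N).
             holds M xs (Exists y \<phi>) as \<longrightarrow>
             preserving M xs y {\<phi>} (singletons as) (universe N))))
     \<and>
     (elementary_substructure \<Sigma> N M \<longleftrightarrow>
       (\<forall>xs y \<phi>. formula_in \<Sigma> (xs @ [y]) \<phi> \<longrightarrow>
          (\<forall>as \<in> tuples (length xs) (universe N).
             disjoint_at M xs y {\<phi>} as (universe M) \<or>
             preserving M xs y {\<phi>} (singletons as) (universe N))))
     \<and>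
     (elementary_substructure \<Sigma> N M \<longleftrightarrow>
       (\<forall>xs y \<Phi>. finite \<Phi> \<and> type_in \<Sigma> (xs @ [y]) \<Phi> \<longrightarrow>
          (\<forall>as \<in> tuples (length xs) (universe N).
             disjoint_at M xs y \<Phi> as (universe M) \<or>
             preserving M xs y \<Phi> (singletons as) (universe N))))"
proof -
  \<comment> \<open>A product of singletons contains exactly one tuple, so quantifying over it
    existentially or universally makes no difference.\<close>
  have pres_iff: "preserving M xs y \<Phi> (singletons as) (universe N) \<longleftrightarrow>
      solutions M xs y \<Phi> as \<inter> universe N \<noteq> {}" for xs y \<Phi> as
    using pres
    by (auto simp: ex_partially_preserving_def all_partially_preserving_def listset_singletons)
  have elem_iff: "elementary_substructure \<Sigma> N M \<longleftrightarrow> tarski_vaught \<Sigma> N M"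
  proof
    assume elem: "elementary_substructure \<Sigma> N M"
    show "tarski_vaught \<Sigma> N M"
      unfolding tarski_vaught_def
    proof (intro allI impI ballI)
      fix xs y \<phi> as
      assume "formula_in \<Sigma> (xs @ [y]) \<phi>" "as \<in> tuples (length xs) (universe N)"
        and "solutions M xs y {\<phi>} as \<noteq> {}"
      then show "solutions M xs y {\<phi>} as \<inter> universe N \<noteq> {}"
        by (intro elementary_realises_finite_type[OF elem])
          (auto simp: type_in_def formula_in_def)
    qed
  qed (rule tarski_vaught_imp_elementary[OF sub])
  have c2: "elementary_substructure \<Sigma> N M \<longleftrightarrow>
      (\<forall>xs y \<phi>. formula_in \<Sigma> (xs @ [y]) \<phi> \<longrightarrow>
         (\<forall>as \<in> tuples (length xs) (universe N).
            holds M xs (Exists y \<phi>) as \<longrightarrow>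
            preserving M xs y {\<phi>} (singletons as) (universe N)))"
  proof -
    have "holds M xs (Exists y \<phi>) as \<longleftrightarrow> solutions M xs y {\<phi>} as \<noteq> {}"
      if "formula_in \<Sigma> (xs @ [y]) \<phi>" "as \<in> tuples (length xs) (universe N)" for xs y \<phi> as
      using that by (intro holds_Exists_iff) (auto simp: tuples_def)
    then show ?thesis
      unfolding elem_iff tarski_vaught_def pres_iff by blast
  qed
  have c3: "elementary_substructure \<Sigma> N M \<longleftrightarrow>
      (\<forall>xs y \<phi>. formula_in \<Sigma> (xs @ [y]) \<phi> \<longrightarrow>
         (\<forall>as \<in> tuples (length xs) (universe N).
            disjoint_at M xs y {\<phi>} as (universe M) \<or>
            preserving M xs y {\<phi>} (singletons as) (universe N)))"
    \<comment> \<open>Disjointness from the whole universe means that there is no solution, so the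
      disjunction is the implication in the test.\<close>
    unfolding elem_iff tarski_vaught_def pres_iff disjoint_at_universe_iff by blast
  have c4: "elementary_substructure \<Sigma> N M \<longleftrightarrow>
      (\<forall>xs y \<Phi>. finite \<Phi> \<and> type_in \<Sigma> (xs @ [y]) \<Phi> \<longrightarrow>
         (\<forall>as \<in> tuples (length xs) (universe N).
            disjoint_at M xs y \<Phi> as (universe M) \<or>
            preserving M xs y \<Phi> (singletons as) (universe N)))" (is "_ \<longleftrightarrow> ?R")
  proof
    assume "elementary_substructure \<Sigma> N M"
    then show ?R
      unfolding pres_iff disjoint_at_universe_iff
      using elementary_realises_finite_type by blast
  next
    assume R: ?R
    \<comment> \<open>Restricted to one-element types, the condition on finite types is the one on
      single formulas.\<close>
    have "type_in \<Sigma> (xs @ [y]) {\<phi>}" if "formula_in \<Sigma> (xs @ [y]) \<phi>" for xs y \<phi>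
      using that by (simp add: type_in_def formula_in_def)
    with R show "elementary_substructure \<Sigma> N M"
      unfolding c3 by (meson finite.emptyI finite.insertI)
  qed
  from c2 c3 c4 show ?thesis by blast
qed

end
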